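(* Let $k$ be a commutative ring with $\mathbb{Q}\subset k$, $\mathcal{A}$ an associative $k$-algebra, $M$ an $\mathcal{A}$-bimodule, and $\phi:\mathcal{A}\otimes\mathcal{A}\to M$ a Hochschild 2-cocycle. A $k$-linear map $\pi:M\to\mathcal{A}$ is a $\phi$-Rota-Baxter operator if and only if $\pi$ is a solution of $$\frac{1}{2}[\hat{\pi},\hat{\pi}]_{\hat{\mu}}=-\frac{1}{6}[[[\hat{\phi},\hat{\pi}],\hat{\pi}],\hat{\pi}].$$
   Context: Algebras are not necessarily unital. A Hochschild 2-cocycle $\phi\in C^2(\mathcal{A},M)$ is a $k$-bilinear map $\phi:\mathcal{A}\times\mathcal{A}\to M$ with $a\cdot\phi(b,c)-\phi(ab,c)+\phi(a,bc)-\phi(a,b)\cdot c=0$ for all $a,b,c\in\mathcal{A}$. A $k$-linear map $\pi:M\to\mathcal{A}$ is a $\phi$-Rota-Baxter operator if $\pi(m)\pi(n)=\pi(\pi(m)\cdot n+m\cdot\pi(n))+\pi(\phi(\pi(m),\pi(n)))$ for all $m,n\in M$. Lifts to $\mathcal{A}\oplus M$: $\hat{\pi}(a,m):=(\pi(m),0)$; $\hat{\mu}((a,m),(b,n)):=(ab,\,a\cdot n+m\cdot b)$; $\hat{\phi}((a,m),(b,n)):=(0,\phi(a,b))$. Gerstenhaber bracket: for a $k$-module $B$ (here $B=\mathcal{A}\oplus M$) let $G(B):=\bigoplus_{n\ge1}\mathrm{Hom}_k(B^{\otimes n},B)$. For $f\in\mathrm{Hom}_k(B^{\otimes m},B)$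 and $g\in\mathrm{Hom}_k(B^{\otimes n},B)$ set $f\bar{\circ}g:=\sum_{i=1}^m(-1)^{(i-1)(n-1)}f\circ_i g$, where $(f\circ_i g)(b_1,\dots,b_{m+n-1})=f(b_1,\dots,b_{i-1},g(b_i,\dots,b_{i+n-1}),b_{i+n},\dots,b_{m+n-1})$, and $[f,g]:=f\bar{\circ}g-(-1)^{(m-1)(n-1)}g\bar{\circ}f$. The derived bracket is $[f,g]_{\hat{\mu}}:=[[\hat{\mu},f],g]$. *)

theory Defs
  imports "HOL-Analysis.Product_Vector"
begin

section \<open>Algebraic data\<close>

text \<open>
  The inclusion of \<open>\<rat>\<close> in the coefficient ring is given by an injective unital ring
  homomorphism; such a homomorphism is unique if it exists, so \<open>\<iota> (1/2)\<close> and
  \<open>\<iota> (1/6)\<close> are the inverses of 2 and 6.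
\<close>

locale rat_embedding =
  fixes \<iota> :: "rat \<Rightarrow> 'k::comm_ring_1"
  assumes inj: "inj \<iota>"
    and one: "\<iota> 1 = 1"
    and add: "\<iota> (x + y) = \<iota> x + \<iota> y"
    and mult: "\<iota> (x * y) = \<iota> x * \<iota> y"

text \<open>The class \<^class>\<open>ring\<close> is that of associative, not necessarily unital rings.\<close>

locale assoc_algebra = module sA
  for sA :: "'k::comm_ring_1 \<Rightarrow> 'a::ring \<Rightarrow> 'a" +
  assumes scale_mult_left: "sA c a * b = sA c (a * b)"
    and scale_mult_right: "a * sA c b = sA c (a * b)"

locale bimodule = assoc_algebra sA + M: module sM
  for sA :: "'k::comm_ring_1 \<Rightarrow> 'a::ring \<Rightarrow> 'a"
    and sM :: "'k \<Rightarrow> 'm::ab_group_add \<Rightarrow> 'm" +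
  fixes lact :: "'a \<Rightarrow> 'm \<Rightarrow> 'm"
    and ract :: "'m \<Rightarrow> 'a \<Rightarrow> 'm"
  assumes lact_linear: "module_hom sM sM (lact a)"
    and lact_linear_left: "module_hom sA sM (\<lambda>a. lact a m)"
    and ract_linear: "module_hom sA sM (ract m)"
    and ract_linear_left: "module_hom sM sM (\<lambda>m. ract m a)"
    and lact_assoc: "lact (a * b) m = lact a (lact b m)"
    and ract_assoc: "ract m (a * b) = ract (ract m a) b"
    and lact_ract: "ract (lact a m) b = lact a (ract m b)"

locale hochschild_2_cocycle = bimodule sA sM lact ract
  for sA :: "'k::comm_ring_1 \<Rightarrow> 'a::ring \<Rightarrow> 'a"
    and sM :: "'k \<Rightarrow> 'm::ab_group_add \<Rightarrow> 'm"
    and lact :: "'a \<Rightarrow> 'm \<Rightarrow> 'm"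
    and ract :: "'m \<Rightarrow> 'a \<Rightarrow> 'm" +
  fixes \<phi> :: "'a \<Rightarrow> 'a \<Rightarrow> 'm"
  assumes cocycle_linear_left: "module_hom sA sM (\<lambda>a. \<phi> a b)"
    and cocycle_linear_right: "module_hom sA sM (\<phi> a)"
    and cocycle: "lact a (\<phi> b c) - \<phi> (a * b) c + \<phi> a (b * c) - ract (\<phi> a b) c = 0"

definition rota_baxter ::
    "('k::comm_ring_1 \<Rightarrow> 'a::ring \<Rightarrow> 'a) \<Rightarrow> ('k \<Rightarrow> 'm::ab_group_add \<Rightarrow> 'm) \<Rightarrow>
     ('a \<Rightarrow> 'm \<Rightarrow> 'm) \<Rightarrow> ('m \<Rightarrow> 'a \<Rightarrow> 'm) \<Rightarrow> ('a \<Rightarrow> 'a \<Rightarrow> 'm) \<Rightarrow> ('m \<Rightarrow> 'a) \<Rightarrow> bool" where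
  "rota_baxter sA sM lact ract \<phi> \<pi> \<longleftrightarrow>
     module_hom sM sA \<pi> \<and>
     (\<forall>m n. \<pi> m * \<pi> n = \<pi> (lact (\<pi> m) n + ract m (\<pi> n)) + \<pi> (\<phi> (\<pi> m) (\<pi> n)))"


section \<open>Cochains and the Gerstenhaber bracket\<close>

text \<open>
  A homogeneous element of \<open>G(B)\<close>, that is, an element of \<open>Hom(B\<^sup>\<otimes>\<^sup>n, B)\<close> with \<open>n \<ge> 1\<close>,
  is represented by its arity \<open>n\<close> together with the corresponding map on lists of arguments,
  normalised by \<open>cochain\<close> below to be 0 on lists of length other than \<open>n\<close>. Hence two
  normalised cochains of the same arity are equal iff they agree on all lists of length \<open>n\<close>.
  Multilinearity is not part of the type: all cochains used are built by the bracket, which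
  preserves multilinearity, from lifts of linear and bilinear maps.
\<close>

datatype 'b cochain = Cochain (arity: nat) (app: "'b list \<Rightarrow> 'b")

definition cochain :: "nat \<Rightarrow> ('b list \<Rightarrow> 'b::zero) \<Rightarrow> 'b cochain" where
  "cochain n F = Cochain n (\<lambda>bs. if length bs = n then F bs else 0)"

definition scale_cochain :: "('k \<Rightarrow> 'b \<Rightarrow> 'b::zero) \<Rightarrow> 'k \<Rightarrow> 'b cochain \<Rightarrow> 'b cochain" where
  "scale_cochain sB c f = cochain (arity f) (\<lambda>bs. sB c (app f bs))"

text \<open>\<open>signed k x\<close> is \<open>(-1)\<^sup>k x\<close>.\<close>

definition signed :: "nat \<Rightarrow> 'b \<Rightarrow> 'b::ab_group_add" where
  "signed k x = (if even k then x else - x)"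

text \<open>Insertion positions \<open>i\<close> are counted from 1.\<close>

definition insertion :: "'b cochain \<Rightarrow> nat \<Rightarrow> 'b cochain \<Rightarrow> 'b list \<Rightarrow> 'b" where
  "insertion f i g bs =
     app f (take (i - 1) bs @
            [app g (take (arity g) (drop (i - 1) bs))] @
            drop (i - 1 + arity g) bs)"

definition circ_bar :: "'b cochain \<Rightarrow> 'b cochain \<Rightarrow> 'b list \<Rightarrow> 'b::ab_group_add" where
  "circ_bar f g bs =
     (\<Sum>i = 1..arity f. signed ((i - 1) * (arity g - 1)) (insertion f i g bs))"

definition gerstenhaber :: "'b cochain \<Rightarrow> 'b cochain \<Rightarrow> 'b::ab_group_add cochain" where
  "gerstenhaber f g =
     cochain (arity f + arity g - 1)
       (\<lambda>bs. circ_bar f g bs - signed ((arity f - 1) * (arity g - 1)) (circ_bar g f bs))"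

definition derived_bracket ::
    "'b cochain \<Rightarrow> 'b cochain \<Rightarrow> 'b cochain \<Rightarrow> 'b::ab_group_add cochain" where
  "derived_bracket \<mu> f g = gerstenhaber (gerstenhaber \<mu> f) g"


section \<open>Lifts to the direct sum\<close>

text \<open>
  The direct sum of \<open>A\<close> and \<open>M\<close> is the product type, with the componentwise scalar
  multiplication \<^const>\<open>module_prod.scale\<close>.
\<close>

definition cochain1 :: "('b \<Rightarrow> 'b) \<Rightarrow> 'b::zero cochain" where
  "cochain1 F = cochain 1 (\<lambda>bs. F (bs ! 0))"

definition cochain2 :: "('b \<Rightarrow> 'b \<Rightarrow> 'b) \<Rightarrow> 'b::zero cochain" where
  "cochain2 F = cochain 2 (\<lambda>bs. F (bs ! 0) (bs ! 1))"

definition lift_pi :: "('m \<Rightarrow> 'a) \<Rightarrow> ('a::zero \<times> 'm::zero) cochain" where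
  "lift_pi \<pi> = cochain1 (\<lambda>(a, m). (\<pi> m, 0))"

definition lift_mu ::
    "('a \<Rightarrow> 'm \<Rightarrow> 'm) \<Rightarrow> ('m \<Rightarrow> 'a \<Rightarrow> 'm) \<Rightarrow> ('a::ring \<times> 'm::ab_group_add) cochain" where
  "lift_mu lact ract = cochain2 (\<lambda>(a, m) (b, n). (a * b, lact a n + ract m b))"

definition lift_phi :: "('a \<Rightarrow> 'a \<Rightarrow> 'm) \<Rightarrow> ('a::zero \<times> 'm::zero) cochain" where
  "lift_phi \<phi> = cochain2 (\<lambda>(a, m) (b, n). (0, \<phi> a b))"

end

(* Bracketing a bilinear map F with a linear operator P applies the derivation L + R - A, where
   L and R precompose the two arguments with P and A postcomposes with P. These three operators
   commute, and each squares to zero when P = \<pi>^, as \<pi>^ \<pi>^ = 0. Hence bracketing twice gives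
   2 (L R - A (L + R)) and bracketing three times gives -6 A L R; after dividing by 2 and -6,
   equating the first on \<mu>^ with the second on \<phi>^ is the Rota-Baxter identity. *)
theory Submission
  imports Defs
begin

text \<open>The default value 0 sits only on lists of length other than 2, so two-element lists
  recover the map. This turns an equation of cochains into a pointwise identity.\<close>

lemma cochain2_eq_iff: "cochain2 F = cochain2 G \<longleftrightarrow> (\<forall>x y. F x y = G x y)"
proof
  assume eq: "cochain2 F = cochain2 G"
  show "\<forall>x y. F x y = G x y"
  proof (intro allI)
    fix x y
    from eq have "app (cochain2 F) [x, y] = app (cochain2 G) [x, y]" by simp
    then show "F x y = G x y" by (simp add: cochain2_def cochain_def)
  qed
next
  assume "\<forall>x y. F x y = G x y"
  then show "cochain2 F = cochain2 G" by (simp add: cochain2_def)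
qed

lemma scale_cochain2:
  "scale_cochain s c (cochain2 F) = cochain2 (\<lambda>x y. s c (F x y))"
  by (auto simp: scale_cochain_def cochain2_def cochain_def)

text \<open>Since \<open>P\<close> has arity 1, every sign exponent is 0. The result is again a
  \<open>cochain2\<close>, so this rewrite rule evaluates iterated brackets.\<close>

lemma gerstenhaber_cochain2_cochain1:
  "gerstenhaber (cochain2 F) (cochain1 P) =
     cochain2 (\<lambda>x y. F (P x) y + F x (P y) - P (F x y))"
proof -
  have "circ_bar (cochain2 F) (cochain1 P) bs - circ_bar (cochain1 P) (cochain2 F) bs =
      F (P (bs ! 0)) (bs ! 1) + F (bs ! 0) (P (bs ! 1)) - P (F (bs ! 0) (bs ! 1))"
    if "length bs = 2" for bs
  proof -
    from that obtain x y where "bs = [x, y]"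
      by (auto simp: numeral_2_eq_2 length_Suc_conv)
    then show ?thesis
      by (simp add: circ_bar_def insertion_def signed_def cochain1_def cochain2_def cochain_def
          numeral_2_eq_2)
  qed
  then show ?thesis
    by (auto simp: gerstenhaber_def cochain2_def cochain1_def cochain_def signed_def)
qed

text \<open>Being additive and unital, \<open>\<iota>\<close> fixes the natural numbers;
  multiplicativity then transports the inverse from the rationals.\<close>

lemma (in rat_embedding) inverse_of_nat_mult:
  assumes "n > 0"
  shows "\<iota> (1 / of_nat n) * of_nat n = 1"
proof -
  have zero: "\<iota> 0 = 0"
    using add[of 0 0] by simp
  have "\<iota> (of_nat n) = of_nat n"
    by (induction n) (simp_all add: zero one add)
  then have "\<iota> (1 / of_nat n) * of_nat n = \<iota> (1 / of_nat n * of_nat n)"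
    by (simp only: mult)
  also have "\<dots> = 1"
    using assms by (simp add: one)
  finally show ?thesis .
qed

theorem proposition3p10:
  fixes \<iota> :: "rat \<Rightarrow> 'k::comm_ring_1"
    and sA :: "'k \<Rightarrow> 'a::ring \<Rightarrow> 'a"
    and sM :: "'k \<Rightarrow> 'm::ab_group_add \<Rightarrow> 'm"
    and lact :: "'a \<Rightarrow> 'm \<Rightarrow> 'm"
    and ract :: "'m \<Rightarrow> 'a \<Rightarrow> 'm"
    and \<phi> :: "'a \<Rightarrow> 'a \<Rightarrow> 'm"
    and \<pi> :: "'m \<Rightarrow> 'a"
  assumes "rat_embedding \<iota>"
    and "assoc_algebra sA"
    and "bimodule sA sM lact ract"
    and "hochschild_2_cocycle sA sM lact ract \<phi>"
    and "module_hom sM sA \<pi>"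
  shows "rota_baxter sA sM lact ract \<phi> \<pi> \<longleftrightarrow>
    scale_cochain (module_prod.scale sA sM) (\<iota> (1/2))
      (derived_bracket (lift_mu lact ract) (lift_pi \<pi>) (lift_pi \<pi>)) =
    scale_cochain (module_prod.scale sA sM) (- \<iota> (1/6))
      (gerstenhaber (gerstenhaber (gerstenhaber (lift_phi \<phi>) (lift_pi \<pi>)) (lift_pi \<pi>)) (lift_pi \<pi>))"
proof -
  interpret rat_embedding \<iota> by fact
  interpret hochschild_2_cocycle sA sM lact ract \<phi> by fact
  interpret \<pi>: module_hom sM sA \<pi> by fact
  interpret lact: module_hom sM sM "lact a" for a by (rule lact_linear)
  interpret lactl: module_hom sA sM "\<lambda>a. lact a m" for m by (rule lact_linear_left)
  interpret ract: module_hom sA sM "ract m" for m by (rule ract_linear)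
  interpret ractl: module_hom sM sM "\<lambda>m. ract m a" for a by (rule ract_linear_left)
  interpret \<phi>l: module_hom sA sM "\<lambda>a. \<phi> a b" for b by (rule cocycle_linear_left)
  interpret \<phi>r: module_hom sA sM "\<phi> a" for a by (rule cocycle_linear_right)
  interpret prod: module_prod sA sM ..
  \<comment> \<open>These kill the terms where the lift of \<open>\<pi>\<close> is applied twice in
    one place: its values have second component 0.\<close>
  note zeros = lact.zero lactl.zero ract.zero ractl.zero \<phi>l.zero \<phi>r.zero \<pi>.zero
  \<comment> \<open>Multiples are written as sums: a ring without unit has no numerals.\<close>
  have half: "sA (\<iota> (1/2)) (a + a) = a" for a
  proof -
    have "a + a = sA (of_nat 2) a"
      using scale_left_distrib[of 1 1 a] by simp
    then show ?thesis
      using inverse_of_nat_mult[of 2] by simp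
  qed
  have sixth: "sA (- \<iota> (1/6)) (- (a + a + a + a + a + a)) = a" for a
  proof -
    have "a + a + a + a + a + a = sA (1 + 1 + 1 + 1 + 1 + 1) a"
      by (simp only: scale_left_distrib scale_one)
    also have "\<dots> = sA (of_nat 6) a"
      by simp
    finally have "a + a + a + a + a + a = sA (of_nat 6) a" .
    then show ?thesis
      using inverse_of_nat_mult[of 6] by simp
  qed
  \<comment> \<open>\<open>?mc\<close> is the defect of the identity without cocycle,
    \<open>?obs\<close> the cocycle term; the identity says that they agree.\<close>
  let ?mc = "\<lambda>m n. \<pi> m * \<pi> n - \<pi> (lact (\<pi> m) n + ract m (\<pi> n))"
  let ?obs = "\<lambda>m n. \<pi> (\<phi> (\<pi> m) (\<pi> n))"
  have "derived_bracket (lift_mu lact ract) (lift_pi \<pi>) (lift_pi \<pi>) =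
      cochain2 (\<lambda>x y. (?mc (snd x) (snd y) + ?mc (snd x) (snd y), 0))"
    by (simp add: derived_bracket_def lift_mu_def lift_pi_def gerstenhaber_cochain2_cochain1
        cochain2_eq_iff zeros \<pi>.add \<pi>.diff algebra_simps)
  then have lhs: "scale_cochain (module_prod.scale sA sM) (\<iota> (1/2))
      (derived_bracket (lift_mu lact ract) (lift_pi \<pi>) (lift_pi \<pi>)) =
      cochain2 (\<lambda>x y. (?mc (snd x) (snd y), 0))"
    by (simp only: scale_cochain2 prod.scale_prod half M.scale_zero_right)
  \<comment> \<open>The 3! orders of applying L, R and A give the same term, with a minus sign from
    A.\<close>
  have "gerstenhaber (gerstenhaber (gerstenhaber (lift_phi \<phi>) (lift_pi \<pi>)) (lift_pi \<pi>)) (lift_pi \<pi>) =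
      cochain2 (\<lambda>x y. let p = ?obs (snd x) (snd y) in (- (p + p + p + p + p + p), 0))"
    by (simp add: lift_phi_def lift_pi_def gerstenhaber_cochain2_cochain1
        cochain2_eq_iff zeros \<pi>.add \<pi>.diff Let_def algebra_simps)
  then have rhs: "scale_cochain (module_prod.scale sA sM) (- \<iota> (1/6))
      (gerstenhaber (gerstenhaber (gerstenhaber (lift_phi \<phi>) (lift_pi \<pi>)) (lift_pi \<pi>)) (lift_pi \<pi>)) =
      cochain2 (\<lambda>x y. (?obs (snd x) (snd y), 0))"
    by (simp only: scale_cochain2 prod.scale_prod sixth M.scale_zero_right Let_def)
  show ?thesis
    \<comment> \<open>Only the second components of the arguments occur, so quantifying over pairs
      amounts to quantifying over \<open>m\<close> and \<open>n\<close>.\<close>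
    unfolding lhs rhs cochain2_eq_iff rota_baxter_def
    using \<pi>.module_hom_axioms by (simp add: diff_eq_eq add.commute)
qed

end
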